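(* For every integer $k\ge 4$, the graph $\mathcal{S}_k$ defined below (with incoming vertices $i_1,\dots,i_k$ and outgoing vertices $o_1,\dots,o_k$) is a $k$-in-out graph of optimal size, i.e. it is a $k$-in-out graph and no $k$-in-out graph has fewer vertices than $\mathcal{S}_k$ (which has $2k-1$ vertices).
   Context: All graphs are simple, finite, directed graphs. A Hamiltonian path from $u$ to $w$ is a directed simple path starting at $u$, ending at $w$, visiting every vertex exactly once. Let $S$ be a directed graph with $k$ distinct incoming vertices $i_1,\dots,i_k$ and $k$ distinct outgoing vertices $o_1,\dots,o_k$ (a vertex may be both). $S$ is a $k$-in-out graph if: (1) (paired vertices condition) for all $j,m\in\{1,\dots,k\}$ there is a Hamiltonian path in $S$ from $i_j$ to $o_m$ if and only if $j=m$; and (2) (single visit condition) there is no collection of two or more pairwise vertex-disjoint directed paths in $S$, each starting at an incoming vertex and finishing at an outgoing vertex (a single vertex that is both incoming and outgoing counts as such a path), whose union covers all vertices of $S$. "Undirected edge $(a,b)$" below means both directed edges $(a,b)$ and $(b,a)$. $\mathcal{S}_k$ ($k\ge4$) has vertex set $\{1,\dots,2k-1\}$. For even $k\ge4$: undirected edges $(4i-2,4i-1)$, $(4i-1,4i)$, $(4i,4i+1)$ for $i=1,\dots,\frac{k-2}{2}$; directed edges $(4i-2,4i+5)$ and $(4i+1,4i+2)$ for $i=1,\dots,\frac{k-4}{2}$; directed edges $(1,2)$, $(2k-6,2k-1)$, $(2k-3,2k-2)$, $(2k-2,1)$, $(2k-2,5)$, $(2k-1,2k-2)$. For odd $k\ge5$: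 undirected edges $(4i-2,4i-1)$, $(4i-1,4i)$, $(4i,4i+1)$ for $i=1,\dots,\frac{k-1}{2}$; directed edges $(4i-2,4i+5)$ and $(4i+1,4i+2)$ for $i=1,\dots,\frac{k-3}{2}$; directed edges $(1,2)$, $(2k-4,1)$, $(2k-2,5)$. In both cases $i_j=2j-1$ for $j=1,\dots,k$; $o_{2j}=4j+3$ and $o_{2j+1}=4j-3$ for $j=1,\dots,\lfloor\frac{k-3}{2}\rfloor$; for even $k$ additionally $o_1=3$, $o_{k-2}=2k-1$, $o_{k-1}=2k-7$, $o_k=2k-3$; for odd $k$ additionally $o_1=2k-1$, $o_{k-1}=3$, $o_k=2k-5$. *)

theory Defs
  imports "Graph_Theory.Graph_Theory"
begin

definition path_from_to :: "'a pair_pre_digraph \<Rightarrow> 'a \<Rightarrow> 'a list \<Rightarrow> 'a \<Rightarrow> bool" where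
  "path_from_to G u p w \<longleftrightarrow> vpath p (with_proj G) \<and> hd p = u \<and> last p = w"

definition hamiltonian_path :: "'a pair_pre_digraph \<Rightarrow> 'a \<Rightarrow> 'a list \<Rightarrow> 'a \<Rightarrow> bool" where
  "hamiltonian_path G u p w \<longleftrightarrow> path_from_to G u p w \<and> set p = pverts G"

definition paired_vertices ::
    "nat \<Rightarrow> 'a pair_pre_digraph \<Rightarrow> (nat \<Rightarrow> 'a) \<Rightarrow> (nat \<Rightarrow> 'a) \<Rightarrow> bool" where
  "paired_vertices k G inc out \<longleftrightarrow>
     (\<forall>j\<in>{1..k}. \<forall>m\<in>{1..k}. (\<exists>p. hamiltonian_path G (inc j) p (out m)) \<longleftrightarrow> j = m)"

text \<open>A one-element list is a path, so a vertex that is both incoming and outgoing may occur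
  as a member of \<open>P\<close>. The bound on the cardinality also makes \<open>P\<close> finite.\<close>

definition single_visit ::
    "nat \<Rightarrow> 'a pair_pre_digraph \<Rightarrow> (nat \<Rightarrow> 'a) \<Rightarrow> (nat \<Rightarrow> 'a) \<Rightarrow> bool" where
  "single_visit k G inc out \<longleftrightarrow>
     \<not> (\<exists>P. 2 \<le> card P \<and>
           (\<forall>p\<in>P. \<exists>u\<in>inc ` {1..k}. \<exists>w\<in>out ` {1..k}. path_from_to G u p w) \<and>
           pairwise (\<lambda>p q. disjnt (set p) (set q)) P \<and>
           (\<Union>p\<in>P. set p) = pverts G)"

definition in_out_graph ::
    "nat \<Rightarrow> 'a pair_pre_digraph \<Rightarrow> (nat \<Rightarrow> 'a) \<Rightarrow> (nat \<Rightarrow> 'a) \<Rightarrow> bool" where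
  "in_out_graph k G inc out \<longleftrightarrow>
     pair_digraph G \<and>
     inc ` {1..k} \<subseteq> pverts G \<and> inj_on inc {1..k} \<and>
     out ` {1..k} \<subseteq> pverts G \<and> inj_on out {1..k} \<and>
     paired_vertices k G inc out \<and> single_visit k G inc out"

definition undirected :: "('a \<times> 'a) set \<Rightarrow> ('a \<times> 'a) set" where
  "undirected E = E \<union> E\<inverse>"

definition S_arcs_even :: "nat \<Rightarrow> (nat \<times> nat) set" where
  "S_arcs_even k =
     undirected (\<Union>i\<in>{1..(k - 2) div 2}. {(4*i - 2, 4*i - 1), (4*i - 1, 4*i), (4*i, 4*i + 1)}) \<union>
     (\<Union>i\<in>{1..(k - 4) div 2}. {(4*i - 2, 4*i + 5), (4*i + 1, 4*i + 2)}) \<union>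
     {(1, 2), (2*k - 6, 2*k - 1), (2*k - 3, 2*k - 2), (2*k - 2, 1), (2*k - 2, 5), (2*k - 1, 2*k - 2)}"

definition S_arcs_odd :: "nat \<Rightarrow> (nat \<times> nat) set" where
  "S_arcs_odd k =
     undirected (\<Union>i\<in>{1..(k - 1) div 2}. {(4*i - 2, 4*i - 1), (4*i - 1, 4*i), (4*i, 4*i + 1)}) \<union>
     (\<Union>i\<in>{1..(k - 3) div 2}. {(4*i - 2, 4*i + 5), (4*i + 1, 4*i + 2)}) \<union>
     {(1, 2), (2*k - 4, 1), (2*k - 2, 5)}"

definition S_graph :: "nat \<Rightarrow> nat pair_pre_digraph" where
  "S_graph k = \<lparr> pverts = {1..2*k - 1}, parcs = (if even k then S_arcs_even k else S_arcs_odd k) \<rparr>"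

definition S_in :: "nat \<Rightarrow> nat" where
  "S_in j = 2*j - 1"

text \<open>The last two branches are the indices \<open>2 * m\<close> and \<open>2 * m + 1\<close> with
  \<open>1 \<le> m \<le> (k - 3) div 2\<close>; see the two lemmas below.\<close>

definition S_out :: "nat \<Rightarrow> nat \<Rightarrow> nat" where
  "S_out k j =
     (if even k \<and> j = 1 then 3
      else if even k \<and> j = k - 2 then 2*k - 1
      else if even k \<and> j = k - 1 then 2*k - 7
      else if even k \<and> j = k then 2*k - 3
      else if odd k \<and> j = 1 then 2*k - 1
      else if odd k \<and> j = k - 1 then 3
      else if odd k \<and> j = k then 2*k - 5
      else if even j then 4 * (j div 2) + 3
      else 4 * (j div 2) - 3)"

lemma S_out_general:
  assumes "4 \<le> k" and "m \<in> {1..(k - 3) div 2}"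
  shows "S_out k (2*m) = 4*m + 3" and "S_out k (2*m + 1) = 4*m - 3"
proof -
  have "1 \<le> m" "2*m + 3 \<le> k" "even k \<Longrightarrow> 2*m + 4 \<le> k"
    using assms by (auto, presburger+)
  then show "S_out k (2*m) = 4*m + 3" and "S_out k (2*m + 1) = 4*m - 3"
    by (auto simp: S_out_def)
qed

lemma S_out_special:
  assumes "4 \<le> k"
  shows "even k \<Longrightarrow> S_out k 1 = 3" and "even k \<Longrightarrow> S_out k (k - 2) = 2*k - 1"
    and "even k \<Longrightarrow> S_out k (k - 1) = 2*k - 7" and "even k \<Longrightarrow> S_out k k = 2*k - 3"
    and "odd k \<Longrightarrow> S_out k 1 = 2*k - 1" and "odd k \<Longrightarrow> S_out k (k - 1) = 3"
    and "odd k \<Longrightarrow> S_out k k = 2*k - 5"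
  using assms by (auto simp: S_out_def)

end

theory Submission
  imports Defs
begin

text \<open>
  Lower bound: on a Hamiltonian path between paired vertices no arc leads from an outgoing to an
  incoming vertex, since cutting it there would give two paths against the single visit condition.
  So the successors of the \<open>k - 1\<close> outgoing vertices other than the last one are not incoming, and
  together with the \<open>k\<close> incoming vertices they are \<open>2 * k - 1\<close> vertices.

  In \<open>S_graph k\<close> the incoming vertices and the outgoing vertices are both the odd ones, and every
  arc joins numbers of different parity. A path between odd vertices has one more odd than even
  vertex, just as the whole graph does, hence a path cover consists of one path.

  An odd vertex \<open>v\<close> has arcs to \<open>v - 1\<close> and \<open>v + 1\<close> only. Working inwards from both ends, a
  Hamiltonian path ending in \<open>w\<close> moves from each odd \<open>v < w\<close> to \<open>v + 1\<close> and from each odd \<open>v > w\<close>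
  to \<open>v - 1\<close>. As it cannot step back at once, this excludes one of the at most two predecessors of
  every odd vertex near \<open>w\<close>; two of these vertices are then left with the same single predecessor,
  so the path starts in one of them, and one of the two is \<open>w\<close> or would reach \<open>w\<close> in two steps.
\<close>

subsection \<open>The lower bound\<close>

lemma set_vwalk_arcs_subset_iff:
  "set (vwalk_arcs p) \<subseteq> A \<longleftrightarrow> successively (\<lambda>x y. (x, y) \<in> A) p"
  by (induction p rule: vwalk_arcs.induct) auto

text \<open>Trades the arc list of a walk for \<open>successively\<close>, whose append rule handles
  all later cutting and gluing of paths.\<close>

lemma path_from_to_iff:
  "path_from_to G u p w \<longleftrightarrow>
     p \<noteq> [] \<and> distinct p \<and> set p \<subseteq> pverts G \<and> successively (\<lambda>x y. (x, y) \<in> parcs G) p \<and>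
     hd p = u \<and> last p = w"
  by (auto simp: path_from_to_def vpath_def vwalk_def set_vwalk_arcs_subset_iff)

lemma path_from_to_take_drop:
  assumes "path_from_to G u p w" and "Suc i < length p"
  shows "path_from_to G u (take (Suc i) p) (p ! i)"
    and "path_from_to G (p ! Suc i) (drop (Suc i) p) w"
proof -
  have "successively (\<lambda>x y. (x, y) \<in> parcs G) (take (Suc i) p @ drop (Suc i) p)"
    using assms(1) by (simp add: path_from_to_iff)
  then have "successively (\<lambda>x y. (x, y) \<in> parcs G) (take (Suc i) p)"
    "successively (\<lambda>x y. (x, y) \<in> parcs G) (drop (Suc i) p)"
    unfolding successively_append_iff by blast+
  moreover have "last (take (Suc i) p) = p ! i"
    using assms(2) by (simp add: take_Suc_conv_app_nth)
  ultimately show "path_from_to G u (take (Suc i) p) (p ! i)"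
    "path_from_to G (p ! Suc i) (drop (Suc i) p) w"
    using assms
    by (auto simp: path_from_to_iff hd_drop_conv_nth dest: in_set_takeD in_set_dropD)
qed

lemma in_out_graph_no_exit_entry:
  assumes "in_out_graph k G inc out" and "hamiltonian_path G (inc j) p (out j)"
    and "j \<in> {1..k}" and "Suc i < length p" and "p ! i \<in> out ` {1..k}"
  shows "p ! Suc i \<notin> inc ` {1..k}"
proof
  assume entry: "p ! Suc i \<in> inc ` {1..k}"
  have p: "path_from_to G (inc j) p (out j)" "set p = pverts G"
    using assms(2) by (auto simp: hamiltonian_path_def)
  let ?a = "take (Suc i) p" and ?b = "drop (Suc i) p"
  have "distinct (?a @ ?b)" using p by (simp only: append_take_drop_id path_from_to_iff)
  then have disj: "disjnt (set ?a) (set ?b)" by (simp only: distinct_append disjnt_def)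
  moreover have "?a \<noteq> []" using assms(4) by auto
  \<comment> \<open>Equal pieces would make \<open>{?a, ?b}\<close> a singleton and miss the bound
    on the cardinality.\<close>
  ultimately have "?a \<noteq> ?b" by (metis disjnt_self_iff_empty set_empty)
  then have "2 \<le> card {?a, ?b}" by simp
  moreover have "\<forall>q\<in>{?a, ?b}. \<exists>u\<in>inc ` {1..k}. \<exists>w\<in>out ` {1..k}. path_from_to G u q w"
    using path_from_to_take_drop[OF p(1) assms(4)] assms(3,5) entry by blast
  moreover have "pairwise (\<lambda>p q. disjnt (set p) (set q)) {?a, ?b}"
    using disj by (auto simp: pairwise_def disjnt_sym)
  moreover have "(\<Union>q\<in>{?a, ?b}. set q) = pverts G"
    using p(2) by (simp add: set_append[symmetric] del: set_append)
  moreover have "single_visit k G inc out"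
    using assms(1) by (simp add: in_out_graph_def)
  ultimately show False
    unfolding single_visit_def by blast
qed

text \<open>The count is made on positions in the list rather than on vertices, because there
  passing to the successor is the injective map \<open>Suc\<close>.\<close>

lemma in_out_graph_card_verts_ge:
  assumes "in_out_graph k G inc out" and "1 \<le> k"
  shows "2 * k - 1 \<le> card (pverts G)"
proof -
  have "1 \<in> {1..k}" using assms(2) by simp
  moreover have "paired_vertices k G inc out"
    using assms(1) by (simp add: in_out_graph_def)
  ultimately obtain p where p: "hamiltonian_path G (inc 1) p (out 1)"
    unfolding paired_vertices_def by blast
  then have dist: "distinct p" and set: "set p = pverts G" and "p \<noteq> []"
    and last: "last p = out 1"
    by (auto simp: hamiltonian_path_def path_from_to_iff)
  define n where "n = length p"
  have bij: "bij_betw ((!) p) {..<n} (pverts G)"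
    using bij_betw_nth[OF dist refl] set n_def by auto
  have count: "card {i. i < n \<and> p ! i \<in> X} = card X" if "X \<subseteq> pverts G" for X
  proof -
    have "(!) p ` {i. i < n \<and> p ! i \<in> X} = X"
      using bij that unfolding bij_betw_def by (auto simp: image_iff)
    moreover have "inj_on ((!) p) {i. i < n \<and> p ! i \<in> X}"
      using bij by (auto simp: bij_betw_def intro: inj_on_subset)
    ultimately show ?thesis by (metis card_image)
  qed
  let ?I = "inc ` {1..k}" and ?O = "out ` {1..k}"
  have I: "?I \<subseteq> pverts G" "card ?I = k" and O: "?O \<subseteq> pverts G" "card ?O = k"
    using assms(1) by (auto simp: in_out_graph_def card_image)
  \<comment> \<open>\<open>out 1\<close> is the last vertex of the path and has no successor, so it
    is left out.\<close>
  define X where "X = {i. i < n \<and> p ! i \<in> ?O - {out 1}}"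
  define Y where "Y = {i. i < n \<and> p ! i \<in> ?I}"
  have "card X = k - 1"
    unfolding X_def using O assms(2) by (subst count) auto
  moreover have "card Y = k"
    unfolding Y_def using I by (subst count) auto
  moreover have Suc: "Suc i < n" if "i \<in> X" for i
  proof -
    have "i \<noteq> n - 1"
      using that last \<open>p \<noteq> []\<close> by (auto simp: X_def n_def last_conv_nth)
    then show ?thesis using that by (auto simp: X_def)
  qed
  moreover have "Suc ` X \<inter> Y = {}"
    using in_out_graph_no_exit_entry[OF assms(1) p \<open>1 \<in> {1..k}\<close>] Suc
    by (auto simp: X_def Y_def n_def)
  moreover have "Suc ` X \<union> Y \<subseteq> {..<n}"
    using Suc by (auto simp: Y_def)
  moreover have "finite X" "finite Y" by (auto simp: X_def Y_def)
  ultimately have "k - 1 + k \<le> n"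
    using card_mono[of "{..<n}" "Suc ` X \<union> Y"]
    by (simp add: card_Un_disjoint card_image)
  moreover have "card (pverts G) = n"
    using bij bij_betw_same_card by fastforce
  ultimately show ?thesis using assms(2) by simp
qed

subsection \<open>The single visit condition\<close>

text \<open>Summed over a set, this is the number of odd members minus the number of even
  members.\<close>

definition parity_weight :: "nat \<Rightarrow> int" where
  "parity_weight x = (if odd x then 1 else - 1)"

text \<open>Neighbouring vertices cancel in pairs, and with an odd last vertex only an odd head
  leaves one over. The value for an even head carries the induction through the tails.\<close>

lemma sum_list_parity_weight_alternating:
  assumes "successively (\<lambda>x y. odd x \<noteq> odd y) p" and "p \<noteq> []" and "odd (last p)"
  shows "sum_list (map parity_weight p) = (if odd (hd p) then 1 else 0)"
  using assms by (induction p rule: induct_list012) (auto simp: parity_weight_def)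

lemma sum_parity_weight_atLeastAtMost: "sum parity_weight {1..2 * n + 1} = 1"
  by (induction n) (simp_all add: parity_weight_def)

lemma single_visit_if_bipartite:
  fixes G :: "nat pair_pre_digraph"
  assumes verts: "pverts G = {1..2 * n + 1}"
    and bip: "\<And>x y. (x, y) \<in> parcs G \<Longrightarrow> odd x \<noteq> odd y"
    and inc: "\<And>j. j \<in> {1..k} \<Longrightarrow> odd (inc j)"
    and out: "\<And>j. j \<in> {1..k} \<Longrightarrow> odd (out j)"
  shows "single_visit k G inc out"
  unfolding single_visit_def
proof (rule notI, elim exE conjE)
  fix P
  assume card: "2 \<le> card P"
    and paths: "\<forall>p\<in>P. \<exists>u\<in>inc ` {1..k}. \<exists>w\<in>out ` {1..k}. path_from_to G u p w"
    and disj: "pairwise (\<lambda>p q. disjnt (set p) (set q)) P"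
    and cover: "(\<Union>p\<in>P. set p) = pverts G"
  have "sum parity_weight (set p) = 1" if "p \<in> P" for p
  proof -
    have p: "distinct p" "p \<noteq> []" "odd (hd p)" "odd (last p)"
      "successively (\<lambda>x y. (x, y) \<in> parcs G) p"
      using paths that inc out by (fastforce simp: path_from_to_iff)+
    then have "successively (\<lambda>x y. odd x \<noteq> odd y) p"
      using bip by (blast intro: successively_mono)
    with p show ?thesis
      by (simp add: sum_list_parity_weight_alternating sum_list_distinct_conv_sum_set[symmetric])
  qed
  \<comment> \<open>An infinite set has \<open>card\<close> 0, so the cardinality bound also yields
    finiteness.\<close>
  moreover have "finite P" using card by (metis card.infinite not_numeral_le_zero)
  then have "sum parity_weight (\<Union>p\<in>P. set p) = (\<Sum>p\<in>P. sum parity_weight (set p))"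
    using disj by (intro sum.UNION_disjoint) (auto simp: pairwise_def disjnt_def)
  \<comment> \<open>Each path weighs 1, so the weight of the disjoint union counts the paths; the
    weight of the whole vertex set is 1.\<close>
  ultimately have "int (card P) = sum parity_weight {1..2 * n + 1}"
    using cover verts by simp
  with card show False by (simp only: sum_parity_weight_atLeastAtMost)
qed

subsection \<open>The successor relation of a Hamiltonian path\<close>

text \<open>Abstracts from the list: \<open>N x y\<close> stands for \<open>y\<close> coming
  directly after \<open>x\<close>. Of the absence of cycles only \<open>asym\<close> is kept, and of
  the number of vertices only \<open>no_shortcut\<close>.\<close>

locale hamiltonian_succession =
  fixes V :: "'a set" and A :: "('a \<times> 'a) set" and u w :: 'a and N :: "'a \<Rightarrow> 'a \<Rightarrow> bool"
  assumes end_in: "w \<in> V"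
    and succ_ex: "x \<in> V \<Longrightarrow> x \<noteq> w \<Longrightarrow> \<exists>y. N x y"
    and pred_ex: "y \<in> V \<Longrightarrow> y \<noteq> u \<Longrightarrow> \<exists>x. N x y"
    and arc: "N x y \<Longrightarrow> (x, y) \<in> A"
    and succ_unique: "N x y \<Longrightarrow> N x y' \<Longrightarrow> y = y'"
    and pred_unique: "N x y \<Longrightarrow> N x' y \<Longrightarrow> x = x'"
    and asym: "N x y \<Longrightarrow> \<not> N y x"
    and no_shortcut: "N u x \<Longrightarrow> \<not> N x w"
    and distinct_ends: "u \<noteq> w"

text \<open>With more than three vertices the second vertex is not the last but one, which is what
  \<open>no_shortcut\<close> says.\<close>

lemma hamiltonian_path_succession:
  assumes "hamiltonian_path G u p w" and "3 < card (pverts G)"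
  shows "hamiltonian_succession (pverts G) (parcs G) u w
           (\<lambda>x y. \<exists>i. Suc i < length p \<and> p ! i = x \<and> p ! Suc i = y)"
proof -
  have dist: "distinct p" and set: "set p = pverts G" and ne: "p \<noteq> []"
    and hd: "u = p ! 0" and last: "w = p ! (length p - 1)"
    and succ: "successively (\<lambda>x y. (x, y) \<in> parcs G) p"
    using assms(1)
    by (auto simp: hamiltonian_path_def path_from_to_iff hd_conv_nth last_conv_nth)
  have len: "3 < length p"
    using assms(2) dist set by (metis distinct_card)
  have eq: "i = j" if "p ! i = p ! j" "i < length p" "j < length p" for i j
    using that dist by (simp add: nth_eq_iff_index_eq)
  show ?thesis
  proof
    show "w \<in> pverts G"
      using set ne last by (metis diff_less length_greater_0_conv nth_mem zero_less_one)
    have "p ! 0 \<noteq> p ! (length p - 1)" using eq[of 0 "length p - 1"] len by linarith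
    then show "u \<noteq> w" using hd last by simp
  next
    fix x assume "x \<in> pverts G" "x \<noteq> w"
    then obtain i where "i < length p" "p ! i = x" "i \<noteq> length p - 1"
      using set last by (metis in_set_conv_nth)
    then show "\<exists>y i. Suc i < length p \<and> p ! i = x \<and> p ! Suc i = y"
      by (metis Suc_lessI diff_Suc_1)
  next
    fix y assume "y \<in> pverts G" "y \<noteq> u"
    then obtain i where "i < length p" "p ! i = y" "i \<noteq> 0"
      using set hd by (metis in_set_conv_nth)
    then show "\<exists>x i. Suc i < length p \<and> p ! i = x \<and> p ! Suc i = y"
      by (metis not0_implies_Suc)
  next
    fix x y assume "\<exists>i. Suc i < length p \<and> p ! i = x \<and> p ! Suc i = y"
    then obtain i where i: "Suc i < length p" "p ! i = x" "p ! Suc i = y" by blast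
    \<comment> \<open>Cutting behind position \<open>i\<close> exposes the wanted arc as the
      junction condition of \<open>successively_append_iff\<close>.\<close>
    have "p = take (Suc i) p @ drop (Suc i) p" by simp
    then have "(last (take (Suc i) p), hd (drop (Suc i) p)) \<in> parcs G"
      using succ i by (metis (no_types, lifting) append.right_neutral drop_eq_Nil2 not_less
          successively_append_iff take_eq_Nil2 Zero_not_Suc ne)
    then show "(x, y) \<in> parcs G"
      using i by (simp add: hd_drop_conv_nth take_Suc_conv_app_nth)
  next
    fix x assume "\<exists>i. Suc i < length p \<and> p ! i = u \<and> p ! Suc i = x"
    then have "x = p ! 1" using eq hd ne by (metis One_nat_def Suc_lessD length_greater_0_conv)
    show "\<not> (\<exists>i. Suc i < length p \<and> p ! i = x \<and> p ! Suc i = w)"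
    proof
      assume "\<exists>i. Suc i < length p \<and> p ! i = x \<and> p ! Suc i = w"
      then obtain i where "Suc i < length p" "p ! i = p ! 1" "p ! Suc i = p ! (length p - 1)"
        using \<open>x = p ! 1\<close> last by blast
      then have "i = 1" "Suc i = length p - 1" using eq len by auto
      then show False using len by simp
    qed
  \<comment> \<open>Both uniqueness properties and \<open>asym\<close> remain; they hold because
    equal vertices occupy equal positions.\<close>
  qed (use eq in \<open>metis Suc_lessD Suc_inject n_not_Suc_n Suc_n_not_le_n le_SucI order_refl\<close>)+
qed

section \<open>Forced moves of the odd vertices\<close>

text \<open>The common frame for both parities of \<open>k\<close>. The range in
  \<open>out_odd\<close> leaves 1 and \<open>K\<close> a single neighbour each, from which the two
  inductions below start.\<close>

locale zigzag = hamiltonian_succession "{1..K}" A u w N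
  for K :: nat and A u w N +
  assumes odd_K: "odd K" and odd_end: "odd w"
    and out_odd: "odd x \<Longrightarrow> (x, y) \<in> A \<Longrightarrow> y \<in> {1..K} \<and> (y = x + 1 \<or> y + 1 = x)"
begin

text \<open>Induction upwards from 1: a step down would lead to 0 if \<open>v = 1\<close>, and
  otherwise to a vertex that already has the predecessor \<open>v - 2\<close>.\<close>

lemma N_below:
  assumes "odd v" and "v < w"
  shows "N v (v + 1)"
  using assms
proof (induction v rule: less_induct)
  case (less v)
  have "v \<in> {1..K}" using less.prems end_in by (auto elim: oddE)
  then obtain y where y: "N v y" using succ_ex less.prems by blast
  then have cases: "y \<in> {1..K}" "y = v + 1 \<or> y + 1 = v"
    using out_odd[OF less.prems(1) arc] by blast+
  have False if "y + 1 = v"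
  proof -
    have "N (v - 2) (v - 2 + 1)"
      using that cases less.prems by (intro less.IH) auto
    moreover have "v - 2 + 1 = y"
      using that cases less.prems by (cases "v \<le> 1") auto
    ultimately have "v - 2 = v" using y pred_unique by metis
    then show False using that by simp
  qed
  then show ?case using cases y by blast
qed

lemma N_above:
  assumes "odd v" and "w < v" and "v \<le> K"
  shows "N v (v - 1)"
  using assms
proof (induction "K - v" arbitrary: v rule: less_induct)
  case less
  have "v \<in> {1..K}" using less.prems end_in by auto
  then obtain y where y: "N v y" using succ_ex less.prems by blast
  then have cases: "y \<in> {1..K}" "y = v + 1 \<or> y + 1 = v"
    using out_odd[OF less.prems(1) arc] by blast+
  have False if "y = v + 1"
  proof -
    \<comment> \<open>The successor \<open>v + 1\<close> is even and \<open>K\<close> is odd, so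
      there is room for one more vertex.\<close>
    have "v + 2 \<le> K"
      using that cases less.prems odd_K
      by (metis Suc_leI add.commute add_2_eq_Suc' atLeastAtMost_iff even_Suc le_neq_implies_less
          plus_1_eq_Suc)
    then have "N (v + 2) (v + 2 - 1)"
      using less.prems by (intro less.hyps) auto
    then have "N (v + 2) y" using that by simp
    then have "v + 2 = v" using y pred_unique by metis
    then show False by simp
  qed
  then show ?case using cases y by (metis add_diff_cancel_right')
qed

text \<open>\<open>N_below\<close> takes \<open>v\<close> to \<open>c\<close>, so
  \<open>asym\<close> excludes \<open>c\<close> as a predecessor. Two such facts with the same
  \<open>e\<close> collide in \<open>succ_unique\<close> unless one of the two vertices is the
  start.\<close>

lemma start_or_pred_below:
  assumes "odd v" and "v < w" and "c = v + 1" and "\<And>x. (x, v) \<in> A \<Longrightarrow> x = e \<or> x = c"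
  shows "u = v \<or> N e v"
proof -
  have "v \<in> {1..K}" using assms(1,2) end_in by (auto elim: oddE)
  then show ?thesis
    using N_below[OF assms(1,2)] pred_ex assms(3,4) arc asym by metis
qed

lemma start_or_pred_above:
  assumes "odd v" and "w < v" and "v \<le> K" and "v = c + 1"
    and "\<And>x. (x, v) \<in> A \<Longrightarrow> x = e \<or> x = c"
  shows "u = v \<or> N e v"
proof -
  have "v \<in> {1..K}" "N v c" using assms(2-4) N_above[OF assms(1-3)] by auto
  then show ?thesis
    using pred_ex assms(5) arc asym by metis
qed

lemma start_or_pred_unique:
  assumes "v \<in> {1..K}" and "\<And>x. (x, v) \<in> A \<Longrightarrow> x = e"
  shows "u = v \<or> N e v"
  using assms pred_ex arc by metis

lemma succ_of_even:
  assumes "x \<in> {1..K}" and "even x"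
  obtains y where "N x y" "(x, y) \<in> A"
  using assms odd_end succ_ex arc by metis

text \<open>From \<open>v\<close> the path would go to \<open>c\<close> and then either back or
  straight to the end \<open>w\<close>, against \<open>asym\<close> or
  \<open>no_shortcut\<close>.\<close>

lemma start_not_below:
  assumes "odd v" and "w = v + 2" and "c = v + 1" and "\<And>y. (c, y) \<in> A \<Longrightarrow> y = v \<or> y = w"
  shows "u \<noteq> v"
proof
  assume "u = v"
  have "N v c" using assms(1-3) N_below by simp
  moreover have "c \<in> {1..K}" "even c"
    using assms(1-3) end_in by auto
  then obtain y where "N c y" "(c, y) \<in> A"
    using succ_of_even by blast
  ultimately show False
    using assms(4) asym no_shortcut \<open>u = v\<close> by metis
qed

lemma start_not_above:
  assumes "v \<le> K" and "v = w + 2" and "c = w + 1" and "\<And>y. (c, y) \<in> A \<Longrightarrow> y = w \<or> y = v"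
  shows "u \<noteq> v"
proof
  assume "u = v"
  have "N v (v - 1)" using assms(1,2) odd_end by (intro N_above) auto
  then have "N v c" using assms(2,3) by simp
  moreover have "c \<in> {1..K}" "even c"
    using assms(1-3) odd_end by auto
  then obtain y where "N c y" "(c, y) \<in> A"
    using succ_of_even by blast
  ultimately show False
    using assms(4) asym no_shortcut \<open>u = v\<close> by metis
qed

end

subsection \<open>Arcs and outgoing vertices of the graphs\<close>

lemma UN_atLeast1_shift: "(\<Union>i\<in>{1..n}. F i) = (\<Union>i<n. F (Suc i))"
proof -
  have "{1..n} = Suc ` {..<n}" by (simp add: image_Suc_lessThan)
  then show ?thesis by (simp only: image_image UN_simps)
qed

text \<open>The substitution for \<open>k\<close> and the index shift remove divisions and truncated
  subtractions. The vertices become 1, the blocks \<open>4*i + 2, ..., 4*i + 5\<close> for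
  \<open>i \<le> n\<close>, and \<open>4*n + 6\<close>, \<open>4*n + 7\<close>.\<close>

lemma S_arcs_even_eq:
  "S_arcs_even (2*n + 4) =
     undirected (\<Union>i<n + 1. {(4*i + 2, 4*i + 3), (4*i + 3, 4*i + 4), (4*i + 4, 4*i + 5)}) \<union>
     (\<Union>i<n. {(4*i + 2, 4*i + 9), (4*i + 5, 4*i + 6)}) \<union>
     {(1, 2), (4*n + 2, 4*n + 7), (4*n + 5, 4*n + 6), (4*n + 6, 1), (4*n + 6, 5), (4*n + 7, 4*n + 6)}"
proof -
  have "(2*n + 4 - 2) div 2 = n + 1" "(2*n + 4 - 4) div 2 = n"
    "2 * (2*n + 4) - 6 = 4*n + 2" "2 * (2*n + 4) - 3 = 4*n + 5"
    "2 * (2*n + 4) - 2 = 4*n + 6" "2 * (2*n + 4) - 1 = 4*n + 7"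
    by auto
  moreover have "4 * Suc i - 2 = 4*i + 2" "4 * Suc i - 1 = 4*i + 3" "4 * Suc i = 4*i + 4"
    "4 * Suc i + 1 = 4*i + 5" "4 * Suc i + 5 = 4*i + 9" "4 * Suc i + 2 = 4*i + 6" for i
    by auto
  ultimately show ?thesis
    unfolding S_arcs_even_def UN_atLeast1_shift by (simp only:)
qed

text \<open>Here the vertices are 1 and the blocks for \<open>i \<le> n + 1\<close>, with nothing
  left over at the top.\<close>

lemma S_arcs_odd_eq:
  "S_arcs_odd (2*n + 5) =
     undirected (\<Union>i<n + 2. {(4*i + 2, 4*i + 3), (4*i + 3, 4*i + 4), (4*i + 4, 4*i + 5)}) \<union>
     (\<Union>i<n + 1. {(4*i + 2, 4*i + 9), (4*i + 5, 4*i + 6)}) \<union>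
     {(1, 2), (4*n + 6, 1), (4*n + 8, 5)}"
proof -
  have "(2*n + 5 - 1) div 2 = n + 2" "(2*n + 5 - 3) div 2 = n + 1"
    "2 * (2*n + 5) - 4 = 4*n + 6" "2 * (2*n + 5) - 2 = 4*n + 8"
    by auto
  moreover have "4 * Suc i - 2 = 4*i + 2" "4 * Suc i - 1 = 4*i + 3" "4 * Suc i = 4*i + 4"
    "4 * Suc i + 1 = 4*i + 5" "4 * Suc i + 5 = 4*i + 9" "4 * Suc i + 2 = 4*i + 6" for i
    by auto
  ultimately show ?thesis
    unfolding S_arcs_odd_def UN_atLeast1_shift by (simp only:)
qed

lemma S_arcs_even_bounds:
  assumes "(x, y) \<in> S_arcs_even (2*n + 4)"
  shows "x \<in> {1..4*n + 7}" "y \<in> {1..4*n + 7}" "odd x \<noteq> odd y"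
    "odd x \<Longrightarrow> y = x + 1 \<or> y + 1 = x"
  using assms unfolding S_arcs_even_eq undirected_def by auto

lemma S_arcs_odd_bounds:
  assumes "(x, y) \<in> S_arcs_odd (2*n + 5)"
  shows "x \<in> {1..4*n + 9}" "y \<in> {1..4*n + 9}" "odd x \<noteq> odd y"
    "odd x \<Longrightarrow> y = x + 1 \<or> y + 1 = x"
  using assms unfolding S_arcs_odd_eq undirected_def by auto

text \<open>Shows the shared predecessors: \<open>4*i + 2\<close> for \<open>4*i + 3\<close> and
  \<open>4*i + 9\<close>, \<open>4*n + 6\<close> for 1 and 5, \<open>4*n + 2\<close> for
  \<open>4*n + 3\<close> and \<open>4*n + 7\<close>. The bound in the first clause keeps out
  \<open>4*n + 7\<close>, which has the same residue.\<close>

lemma S_arcs_even_into: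
  assumes "(x, y) \<in> S_arcs_even (2*n + 4)"
  shows "y = 4*i + 3 \<Longrightarrow> i \<le> n \<Longrightarrow> x = 4*i + 2 \<or> x = 4*i + 4"
    and "y = 4*i + 9 \<Longrightarrow> i < n \<Longrightarrow> x = 4*i + 2 \<or> x = 4*i + 8"
    and "y = 4*n + 7 \<Longrightarrow> x = 4*n + 2"
    and "y = 1 \<Longrightarrow> x = 4*n + 6"
    and "y = 5 \<Longrightarrow> x = 4*n + 6 \<or> x = 4"
  using assms unfolding S_arcs_even_eq undirected_def by (auto; presburger)+

lemma S_arcs_even_from:
  assumes "(4*i + 4, y) \<in> S_arcs_even (2*n + 4)"
  shows "y = 4*i + 3 \<or> y = 4*i + 5"
  using assms unfolding S_arcs_even_eq undirected_def by (auto; presburger)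

text \<open>Here \<open>4*n + 7\<close> is the first clause at \<open>i = n + 1\<close>; it shares
  \<open>4*n + 6\<close> with 1 and \<open>4*n + 8\<close> with 5.\<close>

lemma S_arcs_odd_into:
  assumes "(x, y) \<in> S_arcs_odd (2*n + 5)"
  shows "y = 4*i + 3 \<Longrightarrow> x = 4*i + 2 \<or> x = 4*i + 4"
    and "y = 4*i + 9 \<Longrightarrow> x = 4*i + 2 \<or> x = 4*i + 8"
    and "y = 1 \<Longrightarrow> x = 4*n + 6"
    and "y = 5 \<Longrightarrow> x = 4*n + 8 \<or> x = 4"
  using assms unfolding S_arcs_odd_eq undirected_def by (auto; presburger)+

lemma S_arcs_odd_from:
  assumes "(4*i + 4, y) \<in> S_arcs_odd (2*n + 5)"
  shows "y = 4*i + 3 \<or> y = 4*i + 5 \<or> i = n + 1 \<and> y = 5"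
  using assms unfolding S_arcs_odd_eq undirected_def by (auto; presburger)

section \<open>The pairs of incoming and outgoing vertices\<close>

text \<open>The special values at \<open>k - 2\<close> and \<open>k - 1\<close> are the cases
  \<open>i = n\<close> of the two general families, so only the first and the last index stay
  separate.\<close>

lemma S_out_cases_even:
  assumes "t \<in> {1..2*n + 4}"
    and "P 1 3"
    and "\<And>i. i \<le> n \<Longrightarrow> P (4*i + 3) (4*i + 7)"
    and "\<And>i. i \<le> n \<Longrightarrow> P (4*i + 5) (4*i + 1)"
    and "P (4*n + 7) (4*n + 5)"
  shows "P (S_in t) (S_out (2*n + 4) t)"
proof -
  have "t = 1 \<or> (\<exists>i. t = 2*i + 2 \<and> i \<le> n) \<or> (\<exists>i. t = 2*i + 3 \<and> i \<le> n) \<or> t = 2*n + 4"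
    using assms(1) unfolding atLeastAtMost_iff by presburger
  then consider "t = 1" | i where "t = 2*i + 2" "i \<le> n" | i where "t = 2*i + 3" "i \<le> n"
    | "t = 2*n + 4"
    by blast
  then show ?thesis
  proof cases
    case (2 i)
    then have "S_in t = 4*i + 3" "S_out (2*n + 4) t = 4*i + 7"
      by (auto simp: S_in_def S_out_def)
    then show ?thesis using 2 assms(3) by simp
  next
    case (3 i)
    then have "S_in t = 4*i + 5" "S_out (2*n + 4) t = 4*i + 1"
      by (auto simp: S_in_def S_out_def)
    then show ?thesis using 3 assms(4) by simp
  qed (use assms(2,5) in \<open>auto simp: S_in_def S_out_def add.commute\<close>)
qed

text \<open>Here it is the special value at \<open>k\<close> that joins a general family, as its
  case \<open>i = n + 1\<close>.\<close>

lemma S_out_cases_odd: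
  assumes "t \<in> {1..2*n + 5}"
    and "P 1 (4*n + 9)"
    and "\<And>i. i \<le> n \<Longrightarrow> P (4*i + 3) (4*i + 7)"
    and "P (4*n + 7) 3"
    and "\<And>i. i \<le> n + 1 \<Longrightarrow> P (4*i + 5) (4*i + 1)"
  shows "P (S_in t) (S_out (2*n + 5) t)"
proof -
  have "t = 1 \<or> (\<exists>i. t = 2*i + 2 \<and> i \<le> n) \<or> t = 2*n + 4 \<or> (\<exists>i. t = 2*i + 3 \<and> i \<le> n + 1)"
    using assms(1) unfolding atLeastAtMost_iff by presburger
  then consider "t = 1" | i where "t = 2*i + 2" "i \<le> n" | "t = 2*n + 4"
    | i where "t = 2*i + 3" "i \<le> n + 1"
    by blast
  then show ?thesis
  proof cases
    case (2 i)
    then have "S_in t = 4*i + 3" "S_out (2*n + 5) t = 4*i + 7"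
      by (auto simp: S_in_def S_out_def)
    then show ?thesis using 2 assms(3) by simp
  next
    case (4 i)
    then have "S_in t = 4*i + 5" "S_out (2*n + 5) t = 4*i + 1"
      by (auto simp: S_in_def S_out_def, presburger)
    then show ?thesis using 4 assms(5) by simp
  qed (use assms(2,4) in \<open>auto simp: S_in_def S_out_def add.commute\<close>)
qed

subsection \<open>Uniqueness of the start\<close>

text \<open>The ends 1 and 3 use the pair 1, 5 with common predecessor \<open>4*n + 6\<close>. The
  others use a pair \<open>4*i + 3\<close>, \<open>4*i + 9\<close> with \<open>4*i + 2\<close> or,
  at the top, \<open>4*n + 3\<close>, \<open>4*n + 7\<close> with \<open>4*n + 2\<close>.\<close>

lemma S_even_start_unique:
  assumes "t \<in> {1..2*n + 4}"
    and "zigzag (4*n + 7) (S_arcs_even (2*n + 4)) u (S_out (2*n + 4) t) N"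
  shows "u = S_in t"
proof -
  let ?A = "S_arcs_even (2*n + 4)"
  have "zigzag (4*n + 7) ?A u (S_out (2*n + 4) t) N \<longrightarrow> u = S_in t"
  proof (rule S_out_cases_even[OF assms(1), where P = "\<lambda>v w. zigzag (4*n + 7) ?A u w N \<longrightarrow> u = v"];
      intro impI)
    assume "zigzag (4*n + 7) ?A u 3 N"
    then interpret zigzag "4*n + 7" ?A u 3 N .
    have "u = 1 \<or> N (4*n + 6) 1"
      by (rule start_or_pred_unique) (auto dest: S_arcs_even_into(4))
    moreover have "u = 5 \<or> N (4*n + 6) 5"
      by (rule start_or_pred_above[where c = 4]) (auto dest: S_arcs_even_into(5))
    moreover have "u \<noteq> 5"
      using S_arcs_even_from[of 0] by (intro start_not_above[where c = 4]) auto
    ultimately show "u = 1" using succ_unique[of "4*n + 6" 1 5] by auto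
  next
    fix i assume i: "i \<le> n" and "zigzag (4*n + 7) ?A u (4*i + 7) N"
    then interpret zigzag "4*n + 7" ?A u "4*i + 7" N by simp
    have b: "u = 4*i + 3 \<or> N (4*i + 2) (4*i + 3)"
      using i by (intro start_or_pred_below[where c = "4*i + 4"]) (auto dest: S_arcs_even_into(1))
    show "u = 4*i + 3"
    proof (cases "i < n")
      case True
      have "u = 4*i + 9 \<or> N (4*i + 2) (4*i + 9)"
        using True by (intro start_or_pred_above[where c = "4*i + 8"]) (auto dest: S_arcs_even_into(2))
      moreover have "u \<noteq> 4*i + 9"
        using True S_arcs_even_from[of "i + 1"]
        by (intro start_not_above[where c = "4*i + 8"]) (auto simp: add.commute)
      ultimately show ?thesis using b succ_unique[of "4*i + 2" "4*i + 3" "4*i + 9"] by auto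
    next
      \<comment> \<open>There is no vertex \<open>4*i + 9\<close> here; the end
        \<open>4*n + 7\<close> itself takes its place in the pair.\<close>
      case False
      then have "i = n" using i by simp
      have "u = 4*n + 7 \<or> N (4*n + 2) (4*n + 7)"
        by (rule start_or_pred_unique) (auto dest: S_arcs_even_into(3))
      then show ?thesis
        using b \<open>i = n\<close> distinct_ends succ_unique[of "4*n + 2" "4*n + 3" "4*n + 7"] by auto
    qed
  next
    fix i assume i: "i \<le> n" and "zigzag (4*n + 7) ?A u (4*i + 1) N"
    then interpret zigzag "4*n + 7" ?A u "4*i + 1" N by simp
    show "u = 4*i + 5"
    proof (cases i)
      case 0
      have "u = 1 \<or> N (4*n + 6) 1"
        by (rule start_or_pred_unique) (auto dest: S_arcs_even_into(4))
      moreover have "u = 5 \<or> N (4*n + 6) 5"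
        using 0 by (intro start_or_pred_above[where c = 4]) (auto dest: S_arcs_even_into(5))
      ultimately show ?thesis using 0 distinct_ends succ_unique[of "4*n + 6" 1 5] by auto
    next
      case (Suc j)
      have "u = 4*j + 3 \<or> N (4*j + 2) (4*j + 3)"
        using Suc i by (intro start_or_pred_below[where c = "4*j + 4"]) (auto dest: S_arcs_even_into(1))
      moreover have "u = 4*j + 9 \<or> N (4*j + 2) (4*j + 9)"
        using Suc i by (intro start_or_pred_above[where c = "4*j + 8"]) (auto dest: S_arcs_even_into(2))
      moreover have "u \<noteq> 4*j + 3"
        using Suc S_arcs_even_from[of j]
        by (intro start_not_below[where c = "4*j + 4"]) (auto simp: add.commute)
      ultimately show ?thesis using Suc succ_unique[of "4*j + 2" "4*j + 3" "4*j + 9"] by auto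
    qed
  next
    assume "zigzag (4*n + 7) ?A u (4*n + 5) N"
    then interpret zigzag "4*n + 7" ?A u "4*n + 5" N .
    have "u = 4*n + 3 \<or> N (4*n + 2) (4*n + 3)"
      by (intro start_or_pred_below[where c = "4*n + 4"]) (auto dest: S_arcs_even_into(1))
    moreover have "u = 4*n + 7 \<or> N (4*n + 2) (4*n + 7)"
      by (rule start_or_pred_unique) (auto dest: S_arcs_even_into(3))
    moreover have "u \<noteq> 4*n + 3"
      using S_arcs_even_from[of n] by (intro start_not_below[where c = "4*n + 4"]) auto
    ultimately show "u = 4*n + 7"
      using succ_unique[of "4*n + 2" "4*n + 3" "4*n + 7"] by auto
  qed
  then show ?thesis using assms(2) by blast
qed

text \<open>For odd \<open>k\<close> the arc from \<open>4*n + 8\<close> to \<open>5\<close> gives its source a third successor; it is needed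
  only for the Hamiltonian path that ends in \<open>3\<close>.\<close>

lemma (in zigzag) S_odd_extra_arc_unused:
  assumes "A = S_arcs_odd (2*n + 5)" and "K = 4*n + 9" and "3 < w"
  shows "\<not> N (4*n + 8) 5"
proof
  assume *: "N (4*n + 8) 5"
  \<comment> \<open>The path runs from 3 to 4 and, unable to turn back, on to 5, whose predecessor
    is thereby fixed.\<close>
  have "N 3 4" using N_below[of 3] assms(3) by simp
  moreover obtain y where "N 4 y" "(4, y) \<in> A"
    using succ_of_even[of 4] assms(2) by auto
  moreover from this have "y = 3 \<or> y = 5"
    using S_arcs_odd_from[of 0 y n] assms(1) by simp
  ultimately have "N 4 5" using asym by blast
  then show False using * pred_unique[of 4 5 "4*n + 8"] by simp
qed

text \<open>The end \<open>4*n + 9\<close> uses the pair 1, \<open>4*n + 7\<close> with common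
  predecessor \<open>4*n + 6\<close>; the ends 1 and 3 use 5, \<open>4*n + 7\<close> with
  \<open>4*n + 8\<close>; the others use \<open>4*i + 3\<close>, \<open>4*i + 9\<close> with
  \<open>4*i + 2\<close>.\<close>

lemma S_odd_start_unique:
  assumes "t \<in> {1..2*n + 5}"
    and "zigzag (4*n + 9) (S_arcs_odd (2*n + 5)) u (S_out (2*n + 5) t) N"
  shows "u = S_in t"
proof -
  let ?A = "S_arcs_odd (2*n + 5)"
  have from_last: "y = 4*n + 7 \<or> y = 4*n + 9 \<or> y = 5" if "(4*n + 8, y) \<in> ?A" for y
    using S_arcs_odd_from[of "n + 1" y n] that by (simp add: add.commute)
  have into_last: "x = 4*n + 6 \<or> x = 4*n + 8" if "(x, 4*n + 7) \<in> ?A" for x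
    using S_arcs_odd_into(1)[OF that, of "n + 1"] by (simp add: add.commute)
  have "zigzag (4*n + 9) ?A u (S_out (2*n + 5) t) N \<longrightarrow> u = S_in t"
  proof (rule S_out_cases_odd[OF assms(1), where P = "\<lambda>v w. zigzag (4*n + 9) ?A u w N \<longrightarrow> u = v"];
      intro impI)
    assume "zigzag (4*n + 9) ?A u (4*n + 9) N"
    then interpret zigzag "4*n + 9" ?A u "4*n + 9" N .
    have "u = 1 \<or> N (4*n + 6) 1"
      by (rule start_or_pred_unique) (auto dest: S_arcs_odd_into(3))
    moreover have "u = 4*n + 7 \<or> N (4*n + 6) (4*n + 7)"
      by (rule start_or_pred_below[where c = "4*n + 8"]) (auto dest: into_last)
    \<comment> \<open>\<open>start_not_below\<close> does not apply, as the middle vertex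
      \<open>4*n + 8\<close> has the third successor 5; that arc is excluded separately.\<close>
    moreover have "u \<noteq> 4*n + 7"
    proof
      assume u: "u = 4*n + 7"
      have "N (4*n + 7) (4*n + 8)" using N_below[of "4*n + 7"] by (simp add: add.commute)
      moreover obtain y where y: "N (4*n + 8) y" "(4*n + 8, y) \<in> ?A"
        using succ_of_even[of "4*n + 8"] by auto
      moreover have "\<not> N (4*n + 8) 5" by (rule S_odd_extra_arc_unused) auto
      ultimately show False using from_last[OF y(2)] asym no_shortcut u by metis
    qed
    ultimately show "u = 1" using succ_unique[of "4*n + 6" 1 "4*n + 7"] by auto
  next
    fix i assume i: "i \<le> n" and "zigzag (4*n + 9) ?A u (4*i + 7) N"
    then interpret zigzag "4*n + 9" ?A u "4*i + 7" N by simp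
    have "u = 4*i + 3 \<or> N (4*i + 2) (4*i + 3)"
      by (intro start_or_pred_below[where c = "4*i + 4"]) (auto dest: S_arcs_odd_into(1))
    moreover have "u = 4*i + 9 \<or> N (4*i + 2) (4*i + 9)"
      using i by (intro start_or_pred_above[where c = "4*i + 8"]) (auto dest: S_arcs_odd_into(2))
    \<comment> \<open>For \<open>i = n\<close> the middle vertex \<open>4*i + 8\<close> again has
      the extra successor 5.\<close>
    moreover have "u \<noteq> 4*i + 9"
    proof
      assume u: "u = 4*i + 9"
      have "N (4*i + 9) (4*i + 8)" using N_above[of "4*i + 9"] i by (simp add: add.commute)
      moreover obtain y where y: "N (4*i + 8) y" "(4*i + 8, y) \<in> ?A"
        using succ_of_even[of "4*i + 8"] i by auto
      moreover have "\<not> N (4*n + 8) 5" by (rule S_odd_extra_arc_unused) auto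
      moreover have "y = 4*i + 7 \<or> y = 4*i + 9 \<or> i = n \<and> y = 5"
        using S_arcs_odd_from[of "i + 1" y n] y(2) by (simp add: add.commute)
      ultimately show False using asym no_shortcut u by metis
    qed
    ultimately show "u = 4*i + 3" using succ_unique[of "4*i + 2" "4*i + 3" "4*i + 9"] by auto
  next
    assume "zigzag (4*n + 9) ?A u 3 N"
    then interpret zigzag "4*n + 9" ?A u 3 N .
    have "u = 5 \<or> N (4*n + 8) 5"
      by (rule start_or_pred_above[where c = 4]) (auto dest: S_arcs_odd_into(4))
    moreover have "u \<noteq> 5"
      using S_arcs_odd_from[of 0] by (intro start_not_above[where c = 4]) auto
    moreover have "u = 4*n + 7 \<or> N (4*n + 8) (4*n + 7)"
      by (rule start_or_pred_above[where c = "4*n + 6"]) (auto dest: into_last)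
    ultimately show "u = 4*n + 7" using succ_unique[of "4*n + 8" 5 "4*n + 7"] by auto
  next
    fix i assume i: "i \<le> n + 1" and "zigzag (4*n + 9) ?A u (4*i + 1) N"
    then interpret zigzag "4*n + 9" ?A u "4*i + 1" N by simp
    show "u = 4*i + 5"
    proof (cases i)
      \<comment> \<open>The end 1 is entered from \<open>4*n + 6\<close>, so a path starting in
        \<open>4*n + 7\<close> would go down to \<open>4*n + 6\<close> and be over after two
        steps.\<close>
      case 0
      have "u = 1 \<or> N (4*n + 6) 1"
        by (rule start_or_pred_unique) (auto dest: S_arcs_odd_into(3))
      then have "N (4*n + 6) 1" using 0 distinct_ends by simp
      moreover have "N (4*n + 7) (4*n + 6)" using N_above[of "4*n + 7"] 0 by (simp add: add.commute)
      ultimately have "u \<noteq> 4*n + 7" using no_shortcut 0 by auto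
      moreover have "u = 4*n + 7 \<or> N (4*n + 8) (4*n + 7)"
        using 0 by (intro start_or_pred_above[where c = "4*n + 6"]) (auto dest: into_last)
      moreover have "u = 5 \<or> N (4*n + 8) 5"
        using 0 by (intro start_or_pred_above[where c = 4]) (auto dest: S_arcs_odd_into(4))
      ultimately show ?thesis using 0 succ_unique[of "4*n + 8" 5 "4*n + 7"] by auto
    next
      case (Suc j)
      have "u = 4*j + 3 \<or> N (4*j + 2) (4*j + 3)"
        using Suc by (intro start_or_pred_below[where c = "4*j + 4"]) (auto dest: S_arcs_odd_into(1))
      moreover have "u = 4*j + 9 \<or> N (4*j + 2) (4*j + 9)"
        if "j \<le> n" using Suc that
        by (intro start_or_pred_above[where c = "4*j + 8"]) (auto dest: S_arcs_odd_into(2))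
      moreover have "u \<noteq> 4*j + 3"
        using Suc i S_arcs_odd_from[of j _ n]
        by (intro start_not_below[where c = "4*j + 4"]) (auto simp: add.commute)
      ultimately show ?thesis using Suc i succ_unique[of "4*j + 2" "4*j + 3" "4*j + 9"] by auto
    qed
  qed
  then show ?thesis using assms(2) by blast
qed

subsection \<open>Existence of Hamiltonian paths\<close>

text \<open>The Hamiltonian paths run through part of the graph in increasing order and through the rest
  block by block, each block \<open>4*l + 2, \<dots>, 4*l + 5\<close> backwards.\<close>

definition descent :: "nat \<Rightarrow> nat \<Rightarrow> nat list" where
  "descent i j = concat (map (\<lambda>l. [4*l + 5, 4*l + 4, 4*l + 3, 4*l + 2]) [i..<j])"

lemma descent_eq_Nil_iff [simp]: "descent i j = [] \<longleftrightarrow> j \<le> i"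
  by (auto simp: descent_def)

lemma descent_Suc: "i \<le> j \<Longrightarrow> descent i (Suc j) = descent i j @ [4*j + 5, 4*j + 4, 4*j + 3, 4*j + 2]"
  by (simp add: descent_def)

lemma hd_descent [simp]: "i < j \<Longrightarrow> hd (descent i j) = 4*i + 5"
  by (simp add: descent_def upt_conv_Cons)

lemma last_descent [simp]: "i < Suc j \<Longrightarrow> last (descent i (Suc j)) = 4*j + 2"
  by (simp add: descent_Suc)

lemma length_descent [simp]: "length (descent i j) = 4 * (j - i)"
  by (induction j) (auto simp: descent_def)

lemma set_descent:
  assumes "i \<le> j"
  shows "set (descent i j) = {4*i + 2..<4*j + 2}"
  using assms
proof (induction j rule: dec_induct)
  case base
  then show ?case by (simp add: descent_def)
next
  case (step j)
  have "{4*i + 2..<4 * Suc j + 2} = {4*i + 2..<4*j + 2} \<union> {4*j + 5, 4*j + 4, 4*j + 3, 4*j + 2}"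
    using step by auto
  then show ?case using step by (simp add: descent_Suc)
qed

lemma distinct_descent [simp]:
  assumes "i \<le> j"
  shows "distinct (descent i j)"
  using assms set_descent[OF assms] by (intro card_distinct) auto

text \<open>The bottom \<open>4*l + 2\<close> of a block is linked to \<open>4*l + 9\<close>, the
  top of the next block.\<close>

lemma successively_descent:
  assumes "i \<le> j"
    and "\<And>l. l < j \<Longrightarrow> P (4*l + 5) (4*l + 4) \<and> P (4*l + 4) (4*l + 3) \<and> P (4*l + 3) (4*l + 2)"
    and "\<And>l. l + 1 < j \<Longrightarrow> P (4*l + 2) (4*l + 9)"
  shows "successively P (descent i j)"
  using assms
proof (induction j rule: dec_induct)
  case base
  then show ?case by (simp add: descent_def)
next
  case (step j)
  have IH: "successively P (descent i j)" by (rule step.IH) (use step.prems in auto)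
  show ?case
  proof (cases "i < j")
    case True
    then obtain l where l: "j = Suc l" by (cases j) auto
    have "P (4*l + 2) (4*l + 9)" using step.prems(2)[of l] l by simp
    moreover have "last (descent i j) = 4*l + 2" using True l by simp
    moreover have "4*j + 5 = 4*l + 9" using l by simp
    ultimately have "P (last (descent i j)) (4*j + 5)" by metis
    then show ?thesis
      using IH step.prems(1)[of j] step.hyps by (simp add: descent_Suc successively_append_iff)
  next
    case False
    then show ?thesis
      using IH step.prems(1)[of j] step.hyps by (simp add: descent_Suc successively_append_iff)
  qed
qed

lemma successively_upt:
  assumes "\<And>x. a \<le> x \<Longrightarrow> x + 1 < b \<Longrightarrow> P x (x + 1)"
  shows "successively P [a..<b]"
  using assms
proof (induction b)
  case (Suc b)
  show ?case
  proof (cases "a < b")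
    case True
    then obtain c where c: "b = Suc c" by (cases b) auto
    have "P c (c + 1)" using Suc.prems True c by simp
    moreover have "successively P [a..<b]" using Suc.IH Suc.prems by simp
    moreover have "last [a..<b] = c" using True c by simp
    ultimately show ?thesis using True c by (simp add: successively_append_iff)
  qed simp
qed simp

section \<open>Arcs available to the Hamiltonian paths\<close>

lemma S_graph_even: "S_graph (2*n + 4) = \<lparr>pverts = {1..4*n + 7}, parcs = S_arcs_even (2*n + 4)\<rparr>"
  and S_graph_odd: "S_graph (2*n + 5) = \<lparr>pverts = {1..4*n + 9}, parcs = S_arcs_odd (2*n + 5)\<rparr>"
  by (simp_all add: S_graph_def)

lemma S_arcs_even_block:
  assumes "i \<le> n"
  shows "{(4*i + 2, 4*i + 3), (4*i + 3, 4*i + 4), (4*i + 4, 4*i + 5),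
          (4*i + 5, 4*i + 4), (4*i + 4, 4*i + 3), (4*i + 3, 4*i + 2)} \<subseteq> S_arcs_even (2*n + 4)"
proof -
  let ?B = "\<lambda>i. {(4*i + 2, 4*i + 3), (4*i + 3, 4*i + 4), (4*i + 4, 4*i + 5)} :: (nat \<times> nat) set"
  have "?B i \<subseteq> (\<Union>i<n + 1. ?B i)" using assms by (intro UN_upper) simp
  then have "undirected (?B i) \<subseteq> S_arcs_even (2*n + 4)"
    unfolding S_arcs_even_eq undirected_def by blast
  then show ?thesis by (auto simp: undirected_def)
qed

lemma S_arcs_even_link:
  assumes "i < n"
  shows "{(4*i + 2, 4*i + 9), (4*i + 5, 4*i + 6)} \<subseteq> S_arcs_even (2*n + 4)"
  using assms unfolding S_arcs_even_eq
  by (intro le_supI1[OF le_supI2[OF UN_upper[where A = "{..<n}"]]]) simp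

lemma S_arcs_even_rest:
  "{(1, 2), (4*n + 2, 4*n + 7), (4*n + 5, 4*n + 6), (4*n + 6, 1), (4*n + 6, 5), (4*n + 7, 4*n + 6)}
     \<subseteq> S_arcs_even (2*n + 4)"
  unfolding S_arcs_even_eq by (rule Un_upper2)

lemma S_arcs_odd_block:
  assumes "i \<le> n + 1"
  shows "{(4*i + 2, 4*i + 3), (4*i + 3, 4*i + 4), (4*i + 4, 4*i + 5),
          (4*i + 5, 4*i + 4), (4*i + 4, 4*i + 3), (4*i + 3, 4*i + 2)} \<subseteq> S_arcs_odd (2*n + 5)"
proof -
  let ?B = "\<lambda>i. {(4*i + 2, 4*i + 3), (4*i + 3, 4*i + 4), (4*i + 4, 4*i + 5)} :: (nat \<times> nat) set"
  have "?B i \<subseteq> (\<Union>i<n + 2. ?B i)" using assms by (intro UN_upper) simp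
  then have "undirected (?B i) \<subseteq> S_arcs_odd (2*n + 5)"
    unfolding S_arcs_odd_eq undirected_def by blast
  then show ?thesis by (auto simp: undirected_def)
qed

lemma S_arcs_odd_link:
  assumes "i \<le> n"
  shows "{(4*i + 2, 4*i + 9), (4*i + 5, 4*i + 6)} \<subseteq> S_arcs_odd (2*n + 5)"
  using assms unfolding S_arcs_odd_eq
  by (intro le_supI1[OF le_supI2[OF UN_upper[where A = "{..<n + 1}"]]]) simp

lemma S_arcs_odd_rest:
  "{(1, 2), (4*n + 6, 1), (4*n + 8, 5)} \<subseteq> S_arcs_odd (2*n + 5)"
  unfolding S_arcs_odd_eq by (rule Un_upper2)

lemma nat_mod4_cases:
  assumes "1 \<le> (x::nat)"
  obtains "x = 1" | i where "x = 4*i + 2" | i where "x = 4*i + 3" | i where "x = 4*i + 4"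
    | i where "x = 4*i + 5"
proof -
  have "x = 1 \<or> (\<exists>i. x = 4*i + 2) \<or> (\<exists>i. x = 4*i + 3) \<or> (\<exists>i. x = 4*i + 4) \<or> (\<exists>i. x = 4*i + 5)"
    using assms by presburger
  then show ?thesis using that by blast
qed

text \<open>A list of \<open>K\<close> distinct members of \<open>{1..K}\<close> covers this set by
  cardinality, so explicit lists need only a length and a range check.\<close>

lemma hamiltonian_pathI:
  assumes "pverts G = {1..K}" and "0 < K"
    and "successively (\<lambda>x y. (x, y) \<in> parcs G) p"
    and "distinct p" and "set p \<subseteq> {1..K}" and "length p = K" and "hd p = u" and "last p = w"
  shows "hamiltonian_path G u p w"
proof -
  have "card (set p) = card {1..K}" using assms(4,6) by (simp add: distinct_card)
  then have "set p = {1..K}"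
    using assms(5) by (intro card_subset_eq) simp_all
  moreover have "p \<noteq> []" using assms(2,6) by force
  ultimately show ?thesis
    unfolding hamiltonian_path_def path_from_to_iff using assms(1,3,4,7,8) by simp
qed

text \<open>Upward arcs come from the blocks and the links between them. The bound is sharp, since
  no arc leads from \<open>4*n + 6\<close> to \<open>4*n + 7\<close>.\<close>

lemma S_arcs_even_up:
  assumes "1 \<le> x" and "x \<le> 4*n + 5"
  shows "(x, x + 1) \<in> S_arcs_even (2*n + 4)"
  using assms(1)
proof (cases rule: nat_mod4_cases)
  case 1
  show ?thesis by (rule subsetD[OF S_arcs_even_rest]) (simp add: 1)
next
  case (2 i)
  then have "i \<le> n" using assms(2) by simp
  then show ?thesis by (rule subsetD[OF S_arcs_even_block]) (simp add: 2)
next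
  case (3 i)
  then have "i \<le> n" using assms(2) by simp
  then show ?thesis by (rule subsetD[OF S_arcs_even_block]) (simp add: 3)
next
  case (4 i)
  then have "i \<le> n" using assms(2) by simp
  then show ?thesis by (rule subsetD[OF S_arcs_even_block]) (simp add: 4)
next
  case (5 i)
  show ?thesis
  proof (cases "i = n")
    case True
    show ?thesis by (rule subsetD[OF S_arcs_even_rest]) (simp add: 5 True)
  next
    case False
    then have "i < n" using 5 assms(2) by simp
    then show ?thesis by (rule subsetD[OF S_arcs_even_link]) (simp add: 5)
  qed
qed

lemma S_arcs_odd_up:
  assumes "1 \<le> x" and "x \<le> 4*n + 8"
  shows "(x, x + 1) \<in> S_arcs_odd (2*n + 5)"
  using assms(1)
proof (cases rule: nat_mod4_cases)
  case 1
  show ?thesis by (rule subsetD[OF S_arcs_odd_rest]) (simp add: 1)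
next
  case (2 i)
  then have "i \<le> n + 1" using assms(2) by simp
  then show ?thesis by (rule subsetD[OF S_arcs_odd_block]) (simp add: 2)
next
  case (3 i)
  then have "i \<le> n + 1" using assms(2) by simp
  then show ?thesis by (rule subsetD[OF S_arcs_odd_block]) (simp add: 3)
next
  case (4 i)
  then have "i \<le> n + 1" using assms(2) by simp
  then show ?thesis by (rule subsetD[OF S_arcs_odd_block]) (simp add: 4)
next
  case (5 i)
  then have "i \<le> n" using assms(2) by simp
  then show ?thesis by (rule subsetD[OF S_arcs_odd_link]) (simp add: 5)
qed

section \<open>Explicit Hamiltonian paths\<close>

lemma S_even_paths:
  shows "\<exists>p. hamiltonian_path (S_graph (2*n + 4)) 1 p 3"
    and "i \<le> n \<Longrightarrow> \<exists>p. hamiltonian_path (S_graph (2*n + 4)) (4*i + 3) p (4*i + 7)"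
    and "i \<le> n \<Longrightarrow> \<exists>p. hamiltonian_path (S_graph (2*n + 4)) (4*i + 5) p (4*i + 1)"
    and "\<exists>p. hamiltonian_path (S_graph (2*n + 4)) (4*n + 7) p (4*n + 5)"
proof -
  let ?G = "S_graph (2*n + 4)"
  let ?P = "\<lambda>x y. (x, y) \<in> parcs ?G"
  have G: "pverts ?G = {1..4*n + 7}" "parcs ?G = S_arcs_even (2*n + 4)"
    by (simp_all add: S_graph_even)
  have rest: "?P 1 2" "?P (4*n + 2) (4*n + 7)" "?P (4*n + 6) 1" "?P (4*n + 6) 5"
    "?P (4*n + 7) (4*n + 6)"
    unfolding G using S_arcs_even_rest[of n] by auto
  have block: "?P (4*l + 5) (4*l + 4) \<and> ?P (4*l + 4) (4*l + 3) \<and> ?P (4*l + 3) (4*l + 2)"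
    if "l \<le> n" for l
    unfolding G using S_arcs_even_block[OF that] by auto
  have link: "?P (4*l + 2) (4*l + 9)" if "l < n" for l
    unfolding G using S_arcs_even_link[OF that] by auto
  have up: "?P x y" if "1 \<le> x" "x \<le> 4*n + 5" "y = x + 1" for x y
    unfolding G using S_arcs_even_up that by simp
  have down: "successively ?P (descent l (n + 1))" if "l \<le> n + 1" for l
    by (rule successively_descent[OF that]) (use block link in auto)
  have rise: "successively ?P [1..<l]" if "l \<le> 4*n + 7" for l
    by (rule successively_upt) (use up that in auto)
  have K: "0 < 4*n + 7" by simp

  show "\<exists>p. hamiltonian_path ?G 1 p 3"
  proof
    \<comment> \<open>The lowest block is split: 2 is visited on the way out, and 5, 4, 3 after the
      return along the arc from \<open>4*n + 6\<close> to 5.\<close>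
    show "hamiltonian_path ?G 1 ([1, 2] @ descent 1 (n + 1) @ [4*n + 7, 4*n + 6, 5, 4, 3]) 3"
    proof (rule hamiltonian_pathI[OF G(1) K])
      have "?P 2 (hd (descent 1 (n + 1) @ [4*n + 7, 4*n + 6, 5, 4, 3]))"
        using rest(2) link[of 0] by (cases "n = 0") (simp_all add: hd_append del: add_2_eq_Suc')
      moreover have "?P 5 4" "?P 4 3" using block[of 0] by simp_all
      moreover have "n = 0 \<or> ?P (last (descent 1 (n + 1))) (4*n + 7)"
        using rest(2) by (cases "n = 0") simp_all
      ultimately show "successively ?P ([1, 2] @ descent 1 (n + 1) @ [4*n + 7, 4*n + 6, 5, 4, 3])"
        using down[of 1] rest unfolding successively_append_iff by auto
    qed (auto simp: set_descent)
  qed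

  show "\<exists>p. hamiltonian_path ?G (4*i + 3) p (4*i + 7)" if "i \<le> n"
  proof (cases "i = n")
    case True
    let ?p = "[4*n + 3, 4*n + 4, 4*n + 5, 4*n + 6] @ [1..<4*n + 3] @ [4*n + 7]"
    have "hamiltonian_path ?G (4*n + 3) ?p (4*n + 7)"
    proof (rule hamiltonian_pathI[OF G(1) K])
      have "last [1..<4*n + 3] = 4*n + 2" "hd [1..<4*n + 3] = 1" by (simp_all add: hd_upt)
      moreover have "?P (4*n + 3) (4*n + 4)" "?P (4*n + 4) (4*n + 5)" "?P (4*n + 5) (4*n + 6)"
        by (auto intro: up)
      ultimately show "successively ?P ?p"
        using rise[of "4*n + 3"] rest unfolding successively_append_iff by (auto simp: hd_append)
    qed auto
    then show ?thesis using True by blast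
  next
    case False
    then have i: "i < n" using that by simp
    \<comment> \<open>Block \<open>i + 1\<close> is split: its bottom \<open>4*i + 6\<close> leads
      to the later blocks, and its other vertices come last, entered from \<open>4*i + 2\<close>
      after the return to 1.\<close>
    let ?q = "[4*n + 7, 4*n + 6] @ [1..<4*i + 3] @ [4*i + 9, 4*i + 8, 4*i + 7]"
    let ?p = "[4*i + 3, 4*i + 4, 4*i + 5, 4*i + 6] @ descent (i + 2) (n + 1) @ ?q"
    have "hamiltonian_path ?G (4*i + 3) ?p (4*i + 7)"
    proof (rule hamiltonian_pathI[OF G(1) K])
      have "last [1..<4*i + 3] = 4*i + 2" "hd [1..<4*i + 3] = 1" by (simp_all add: hd_upt)
      moreover have "?P (4*i + 9) (4*i + 8)" "?P (4*i + 8) (4*i + 7)"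
        using block[of "i + 1"] i by (simp_all add: add.commute)
      ultimately have "successively ?P ?q"
        using rise[of "4*i + 3"] i rest link[OF i]
        unfolding successively_append_iff by (auto simp: hd_append)
      moreover have "n + 1 \<le> i + 2 \<or> ?P (last (descent (i + 2) (n + 1))) (hd ?q)"
        using rest(2) by (cases "n + 1 \<le> i + 2") simp_all
      moreover have "?P (4*i + 6) (hd (descent (i + 2) (n + 1) @ ?q))"
      proof (cases "i + 2 \<le> n")
        case True
        then have "hd (descent (i + 2) (n + 1) @ ?q) = 4*i + 13"
          by (simp add: hd_append)
        then show ?thesis using link[of "i + 1"] True by (simp add: add.commute)
      next
        case False
        then have "n = i + 1" using i by simp
        then show ?thesis using rest(2) by (simp add: hd_append add.commute)
      qed
      moreover have "?P (4*i + 3) (4*i + 4)" "?P (4*i + 4) (4*i + 5)" "?P (4*i + 5) (4*i + 6)"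
        using i by (auto intro: up)
      ultimately show "successively ?P ?p"
        using down[of "i + 2"] i unfolding successively_append_iff by auto
    qed (use i in \<open>auto simp: set_descent\<close>)
    then show ?thesis by blast
  qed

  \<comment> \<open>Covers the last pair as well: for \<open>i = n + 1\<close> the descent is empty,
    so the path starts in \<open>4*n + 7\<close> and ends in \<open>4*n + 5\<close>.\<close>
  have desc: "hamiltonian_path ?G u (descent i (n + 1) @ [4*n + 7, 4*n + 6] @ [1..<4*i + 2]) (4*i + 1)"
    if i: "i \<le> n + 1" and u: "u = (if i = n + 1 then 4*n + 7 else 4*i + 5)" for i u
  proof (rule hamiltonian_pathI[OF G(1) K])
    have "hd [1..<4*i + 2] = 1" by (simp add: hd_upt)
    then have "successively ?P ([4*n + 7, 4*n + 6] @ [1..<4*i + 2])"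
      using rise[of "4*i + 2"] i rest unfolding successively_append_iff by auto
    moreover have "n + 1 \<le> i \<or> ?P (last (descent i (n + 1))) (4*n + 7)"
      using rest(2) by (cases "n + 1 \<le> i") simp_all
    ultimately show "successively ?P (descent i (n + 1) @ [4*n + 7, 4*n + 6] @ [1..<4*i + 2])"
      using down[OF i] by (subst successively_append_iff) auto
  qed (use i u in \<open>auto simp: set_descent hd_append\<close>)
  show "\<exists>p. hamiltonian_path ?G (4*i + 5) p (4*i + 1)" if "i \<le> n"
    using desc[of i] that by auto
  show "\<exists>p. hamiltonian_path ?G (4*n + 7) p (4*n + 5)"
    using desc[of "n + 1"] by (auto simp: add.commute)
qed


lemma S_odd_paths:
  shows "\<exists>p. hamiltonian_path (S_graph (2*n + 5)) 1 p (4*n + 9)"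
    and "i \<le> n \<Longrightarrow> \<exists>p. hamiltonian_path (S_graph (2*n + 5)) (4*i + 3) p (4*i + 7)"
    and "\<exists>p. hamiltonian_path (S_graph (2*n + 5)) (4*n + 7) p 3"
    and "i \<le> n + 1 \<Longrightarrow> \<exists>p. hamiltonian_path (S_graph (2*n + 5)) (4*i + 5) p (4*i + 1)"
proof -
  let ?G = "S_graph (2*n + 5)"
  let ?P = "\<lambda>x y. (x, y) \<in> parcs ?G"
  have G: "pverts ?G = {1..4*n + 9}" "parcs ?G = S_arcs_odd (2*n + 5)"
    by (simp_all add: S_graph_odd)
  have rest: "?P 1 2" "?P (4*n + 6) 1" "?P (4*n + 8) 5"
    unfolding G using S_arcs_odd_rest[of n] by auto
  have block: "?P (4*l + 5) (4*l + 4) \<and> ?P (4*l + 4) (4*l + 3) \<and> ?P (4*l + 3) (4*l + 2)"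
    if "l \<le> n + 1" for l
    unfolding G using S_arcs_odd_block[OF that] by auto
  have link: "?P (4*l + 2) (4*l + 9)" if "l \<le> n" for l
    unfolding G using S_arcs_odd_link[OF that] by auto
  have up: "?P x y" if "1 \<le> x" "x \<le> 4*n + 8" "y = x + 1" for x y
    unfolding G using S_arcs_odd_up that by simp
  have down: "successively ?P (descent l j)" if "l \<le> j" "j \<le> n + 2" for l j
    by (rule successively_descent[OF that(1)]) (use that(2) block link in auto)
  have last_down: "last (descent l (n + 2)) = 4*n + 6" if "l \<le> n + 1" for l
    using last_descent[of l "n + 1"] that by (simp add: add.commute)
  have rise: "successively ?P [1..<l]" if "l \<le> 4*n + 10" for l
    by (rule successively_upt) (use up that in auto)
  have K: "0 < 4*n + 9" by simp

  show "\<exists>p. hamiltonian_path ?G 1 p (4*n + 9)"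
  proof
    show "hamiltonian_path ?G 1 [1..<4*n + 10] (4*n + 9)"
      by (rule hamiltonian_pathI[OF G(1) K]) (use rise[of "4*n + 10"] in \<open>auto simp: hd_upt\<close>)
  qed

  show "\<exists>p. hamiltonian_path ?G (4*i + 3) p (4*i + 7)" if i: "i \<le> n"
  proof
    \<comment> \<open>As for even \<open>k\<close>, but the descent ends in \<open>4*n + 6\<close>,
      which has an arc to 1. For \<open>i = n\<close> the descent is empty and
      \<open>4*i + 6\<close> is this vertex.\<close>
    let ?q = "[1..<4*i + 3] @ [4*i + 9, 4*i + 8, 4*i + 7]"
    let ?p = "[4*i + 3, 4*i + 4, 4*i + 5, 4*i + 6] @ descent (i + 2) (n + 2) @ ?q"
    have hd_q: "hd ?q = 1" by (simp add: hd_append hd_upt)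
    show "hamiltonian_path ?G (4*i + 3) ?p (4*i + 7)"
    proof (rule hamiltonian_pathI[OF G(1) K])
      have "last [1..<4*i + 3] = 4*i + 2" by simp
      moreover have "?P (4*i + 9) (4*i + 8)" "?P (4*i + 8) (4*i + 7)"
        using block[of "i + 1"] i by (simp_all add: add.commute)
      ultimately have "successively ?P ?q"
        using rise[of "4*i + 3"] i link[OF i] by (auto simp: successively_append_iff)
      moreover have "n + 2 \<le> i + 2 \<or> ?P (last (descent (i + 2) (n + 2))) (hd ?q)"
        using last_down[of "i + 2"] rest(2) hd_q by fastforce
      moreover have "?P (4*i + 6) (hd (descent (i + 2) (n + 2) @ ?q))"
      proof (cases "i < n")
        case True
        then have "hd (descent (i + 2) (n + 2) @ ?q) = 4*i + 13"
          by (simp add: hd_append)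
        then show ?thesis using link[of "i + 1"] True by (simp add: add.commute)
      next
        case False
        then have "n = i" using i by simp
        then have "hd (descent (i + 2) (n + 2) @ ?q) = 1" using hd_q by (simp add: descent_def)
        then show ?thesis using rest(2) \<open>n = i\<close> by simp
      qed
      moreover have "?P (4*i + 3) (4*i + 4)" "?P (4*i + 4) (4*i + 5)" "?P (4*i + 5) (4*i + 6)"
        using i by (auto intro: up)
      ultimately show "successively ?P ?p"
        using down[of "i + 2" "n + 2"] i unfolding successively_append_iff[of _ _ "_ @ _ @ _"]
          successively_append_iff[of _ "descent (i + 2) (n + 2)"] by auto
    qed (use i in \<open>auto simp: set_descent\<close>)
  qed

  show "\<exists>p. hamiltonian_path ?G (4*n + 7) p 3"
  proof
    \<comment> \<open>Both the lowest and the highest block are split; the return uses the arc from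
      \<open>4*n + 8\<close> to 5.\<close>
    let ?q = "[4*n + 9, 4*n + 8, 5, 4, 3]"
    let ?p = "[4*n + 7, 4*n + 6, 1, 2] @ descent 1 (n + 1) @ ?q"
    show "hamiltonian_path ?G (4*n + 7) ?p 3"
    proof (rule hamiltonian_pathI[OF G(1) K])
      have "?P 2 (hd (descent 1 (n + 1) @ ?q))"
        using link[of 0] by (cases "n = 0") (simp_all add: hd_append del: add_2_eq_Suc')
      moreover have "?P 5 4" "?P 4 3" using block[of 0] by simp_all
      moreover have "?P (4*n + 9) (4*n + 8)" "?P (4*n + 7) (4*n + 6)"
        using block[of "n + 1"] by (simp_all add: add.commute)
      moreover have "n = 0 \<or> ?P (last (descent 1 (n + 1))) (4*n + 9)"
      proof (cases "n = 0")
        case False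
        then have "last (descent 1 (n + 1)) = 4*n + 2" using last_descent[of 1 n] by simp
        then show ?thesis using link[of n] by simp
      qed simp
      ultimately show "successively ?P ?p"
        using down[of 1 "n + 1"] rest unfolding successively_append_iff by auto
    qed (auto simp: set_descent)
  qed

  show "\<exists>p. hamiltonian_path ?G (4*i + 5) p (4*i + 1)" if i: "i \<le> n + 1"
  proof
    let ?p = "descent i (n + 2) @ [1..<4*i + 2]"
    show "hamiltonian_path ?G (4*i + 5) ?p (4*i + 1)"
    proof (rule hamiltonian_pathI[OF G(1) K])
      have "?P (last (descent i (n + 2))) (hd [1..<4*i + 2])"
        using last_down[OF i] rest(2)
        by (metis hd_upt less_add_same_cancel2 trans_less_add2 one_less_numeral_iff semiring_norm(76))
      then show "successively ?P ?p"
        using down[of i "n + 2"] rise[of "4*i + 2"] i unfolding successively_append_iff by auto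
    qed (use i in \<open>auto simp: set_descent\<close>)
  qed
qed

section \<open>Assembly of the in-out property\<close>

lemma S_in_out_graph:
  assumes verts: "pverts (S_graph k) = {1..2*k - 1}" and "4 \<le> k"
    and bounds: "\<And>x y. (x, y) \<in> parcs (S_graph k) \<Longrightarrow> x \<in> {1..2*k - 1} \<and> y \<in> {1..2*k - 1}"
    and bip: "\<And>x y. (x, y) \<in> parcs (S_graph k) \<Longrightarrow> odd x \<noteq> odd y"
    and outs: "\<And>x y. (x, y) \<in> parcs (S_graph k) \<Longrightarrow> odd x \<Longrightarrow> y = x + 1 \<or> y + 1 = x"
    and out_bounds: "\<And>t. t \<in> {1..k} \<Longrightarrow> odd (S_out k t) \<and> S_out k t \<le> 2*k - 1"
    and path: "\<And>t. t \<in> {1..k} \<Longrightarrow> \<exists>p. hamiltonian_path (S_graph k) (S_in t) p (S_out k t)"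
    and unique: "\<And>t u N. t \<in> {1..k} \<Longrightarrow>
      zigzag (2*k - 1) (parcs (S_graph k)) u (S_out k t) N \<Longrightarrow> u = S_in t"
  shows "in_out_graph k (S_graph k) S_in (S_out k)"
proof -
  have odd_in: "odd (S_in t)" "S_in t \<le> 2*k - 1" if "t \<in> {1..k}" for t
    using that by (auto simp: S_in_def)
  have inj: "inj_on S_in {1..k}"
    by (auto simp: inj_on_def S_in_def)
  have start: "u = S_in t" if "t \<in> {1..k}" "hamiltonian_path (S_graph k) u p (S_out k t)" for t u p
  proof (rule unique[OF that(1)])
    interpret hamiltonian_succession "{1..2*k - 1}" "parcs (S_graph k)" u "S_out k t"
      "\<lambda>x y. \<exists>i. Suc i < length p \<and> p ! i = x \<and> p ! Suc i = y"
      using hamiltonian_path_succession[OF that(2)] verts assms(2) by simp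
    show "zigzag (2*k - 1) (parcs (S_graph k)) u (S_out k t)
        (\<lambda>x y. \<exists>i. Suc i < length p \<and> p ! i = x \<and> p ! Suc i = y)"
      by unfold_locales (use out_bounds[OF that(1)] bounds outs assms(2) in auto)
  qed
  have "paired_vertices k (S_graph k) S_in (S_out k)"
    unfolding paired_vertices_def using start path inj by (metis inj_onD)
  \<comment> \<open>Indices with the same outgoing vertex have the same start by
    \<open>start\<close>, and \<open>S_in\<close> is injective.\<close>
  moreover have "inj_on (S_out k) {1..k}"
    using start path inj by (intro inj_onI) (metis inj_onD)
  moreover have "single_visit k (S_graph k) S_in (S_out k)"
  proof (rule single_visit_if_bipartite)
    show "pverts (S_graph k) = {1..2 * (k - 1) + 1}" using verts assms(2) by simp
  qed (use bip odd_in out_bounds in auto)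
  moreover have "pair_digraph (S_graph k)"
  proof
    show "fst e \<noteq> snd e" if "e \<in> parcs (S_graph k)" for e
      using bip[of "fst e" "snd e"] that by auto
    show "finite (parcs (S_graph k))"
      by (rule finite_subset[of _ "{1..2*k - 1} \<times> {1..2*k - 1}"]) (use bounds in auto)
  qed (use bounds verts in auto)
  moreover have "S_in ` {1..k} \<subseteq> pverts (S_graph k)" "S_out k ` {1..k} \<subseteq> pverts (S_graph k)"
    using odd_in out_bounds by (auto simp: verts Suc_le_eq odd_pos)
  ultimately show ?thesis using inj unfolding in_out_graph_def by blast
qed

theorem theorem3:
  fixes k :: nat
  assumes "4 \<le> k"
  shows "in_out_graph k (S_graph k) S_in (S_out k) \<and>
         card (pverts (S_graph k)) = 2 * k - 1 \<and>
         (\<forall>(H :: 'a pair_pre_digraph) inc out.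
            in_out_graph k H inc out \<longrightarrow> card (pverts (S_graph k)) \<le> card (pverts H))"
proof -
  have verts: "pverts (S_graph k) = {1..2*k - 1}"
    by (simp add: S_graph_def)
  have "in_out_graph k (S_graph k) S_in (S_out k)"
  proof (cases "even k")
    case True
    then have "\<exists>n. k = 2*n + 4" using assms by presburger
    then obtain n where k: "k = 2*n + 4" by blast
    have K: "2*k - 1 = 4*n + 7" and arcs: "parcs (S_graph k) = S_arcs_even (2*n + 4)"
      using k by (simp_all add: S_graph_even)
    show ?thesis
    proof (rule S_in_out_graph[OF verts assms], unfold K arcs)
      fix t assume t: "t \<in> {1..k}"
      show "odd (S_out k t) \<and> S_out k t \<le> 4*n + 7"
        unfolding k by (rule S_out_cases_even[of t n "\<lambda>_ w. odd w \<and> w \<le> 4*n + 7"])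
          (use t k in auto)
      show "\<exists>p. hamiltonian_path (S_graph k) (S_in t) p (S_out k t)"
        unfolding k
        by (rule S_out_cases_even[of t n "\<lambda>u w. \<exists>p. hamiltonian_path (S_graph (2*n + 4)) u p w"])
          (use t k S_even_paths in auto)
      show "u = S_in t" if "zigzag (4*n + 7) (S_arcs_even (2*n + 4)) u (S_out k t) N" for u N
        using S_even_start_unique that t k by blast
    qed (auto dest: S_arcs_even_bounds)
  next
    case False
    then have "\<exists>n. k = 2*n + 5" using assms by presburger
    then obtain n where k: "k = 2*n + 5" by blast
    have K: "2*k - 1 = 4*n + 9" and arcs: "parcs (S_graph k) = S_arcs_odd (2*n + 5)"
      using k by (simp_all add: S_graph_odd)
    show ?thesis
    proof (rule S_in_out_graph[OF verts assms], unfold K arcs)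
      fix t assume t: "t \<in> {1..k}"
      show "odd (S_out k t) \<and> S_out k t \<le> 4*n + 9"
        unfolding k by (rule S_out_cases_odd[of t n "\<lambda>_ w. odd w \<and> w \<le> 4*n + 9"])
          (use t k in auto)
      show "\<exists>p. hamiltonian_path (S_graph k) (S_in t) p (S_out k t)"
        unfolding k
        by (rule S_out_cases_odd[of t n "\<lambda>u w. \<exists>p. hamiltonian_path (S_graph (2*n + 5)) u p w"])
          (use t k S_odd_paths in auto)
      show "u = S_in t" if "zigzag (4*n + 9) (S_arcs_odd (2*n + 5)) u (S_out k t) N" for u N
        using S_odd_start_unique that t k by blast
    qed (auto dest: S_arcs_odd_bounds)
  qed
  moreover have "card (pverts (S_graph k)) = 2*k - 1" by (simp add: verts)
  ultimately show ?thesis using in_out_graph_card_verts_ge assms by fastforce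
qed

end
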